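(* Let $\mathcal{H}$ be a set of ordered sets. If the duplication of every element of rank $0$ (that is, of every element of $\mathcal{H}\cup\{\emptyset\}$) is representable, then every element of $\mathcal{T}(\mathcal{H})$ is representable.
   Context: "Ordered set" means linearly ordered set. Two ordered sets are similar if there is an order preserving bijection between them. Real valued functions are partially ordered pointwise: $f\le g$ iff $f(x)\le g(x)$ for all $x$. An ordered set is representable if it is similar to a set of Baire 1 functions $\mathbb{R}\to\mathbb{R}$ that is linearly ordered by the pointwise ordering; an order type is representable if some (equivalently every) ordered set of that type is. The duplication of an ordered set $X$ is $X\times\{0,1\}$ with the lexicographical ordering. Given a set $\mathcal{H}$ of ordered sets, the elements of $\mathcal{H}$ and the empty set are called sets of rank $0$ (so $T_0=\mathcal{H}\cup\{\emptyset\}$). For an ordinal $\alpha>0$, an ordered set $X$ is of rank at most $\alpha$ if there exists a countable subset $M\subset X$ such that every maximal interval $I$ of $X\setminus M$ (i.e. every maximal order-convex subset of $X$ contained in $X\setminus M$) is of rank at most $\beta$ for some $\beta<\alpha$, where $\beta$ may depend on $I$. $T_\alpha$ is the class of ordered sets of rank at most $\alpha$, and $\mathcal{T}(\mathcal{H})$ is the collection of order types of the elements of $\bigcup_{\alpha}T_\alpha$, the union being over all ordinals $\alpha$. *)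

theory Defs
  imports "HOL-Analysis.Analysis"
begin

text \<open>
  An ordered set is a reflexive relation \<open>X\<close> with \<open>Linear_order X\<close>. Its underlying set is
  \<open>Field X\<close>, the empty ordered set is \<open>{}\<close>, and \<open>Restr X A\<close> is the subset
  \<open>A \<subseteq> Field X\<close> with the inherited ordering.
\<close>

definition similar :: "'a rel \<Rightarrow> 'b rel \<Rightarrow> bool" where
  "similar X Y \<longleftrightarrow>
     (\<exists>f. bij_betw f (Field X) (Field Y) \<and>
          (\<forall>x\<in>Field X. \<forall>y\<in>Field X. (x, y) \<in> X \<longleftrightarrow> (f x, f y) \<in> Y))"

definition baire_1 :: "(real \<Rightarrow> real) \<Rightarrow> bool" where
  "baire_1 f \<longleftrightarrow>
     (\<exists>g :: nat \<Rightarrow> real \<Rightarrow> real. (\<forall>n. continuous_on UNIV (g n)) \<and>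
        (\<forall>x. (\<lambda>n. g n x) \<longlonglongrightarrow> f x))"

text \<open>Here \<open>f \<le> g\<close> on functions is the pointwise ordering.\<close>

definition pointwise_order :: "(real \<Rightarrow> real) set \<Rightarrow> (real \<Rightarrow> real) rel" where
  "pointwise_order F = {(f, g). f \<in> F \<and> g \<in> F \<and> f \<le> g}"

definition representable :: "'a rel \<Rightarrow> bool" where
  "representable X \<longleftrightarrow>
     (\<exists>F. (\<forall>f\<in>F. baire_1 f) \<and> linear_order_on F (pointwise_order F) \<and>
          similar X (pointwise_order F))"

definition duplication :: "'a rel \<Rightarrow> ('a \<times> nat) rel" where
  "duplication X =
     {((x, i), (y, j)). x \<in> Field X \<and> y \<in> Field X \<and> i \<in> {0, 1} \<and> j \<in> {0, 1} \<and>
        (x \<noteq> y \<and> (x, y) \<in> X \<or> x = y \<and> i \<le> j)}"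

definition order_convex :: "'a rel \<Rightarrow> 'a set \<Rightarrow> bool" where
  "order_convex X I \<longleftrightarrow>
     I \<subseteq> Field X \<and> (\<forall>x\<in>I. \<forall>z\<in>I. \<forall>y. (x, y) \<in> X \<and> (y, z) \<in> X \<longrightarrow> y \<in> I)"

text \<open>\<open>maximal_interval X A I\<close>: among the order-convex subsets of \<open>X\<close> (not merely of \<open>A\<close>)
  that are contained in \<open>A\<close>, the set \<open>I\<close> is maximal.\<close>

definition maximal_interval :: "'a rel \<Rightarrow> 'a set \<Rightarrow> 'a set \<Rightarrow> bool" where
  "maximal_interval X A I \<longleftrightarrow>
     order_convex X I \<and> I \<subseteq> A \<and>
     (\<forall>J. order_convex X J \<and> J \<subseteq> A \<and> I \<subseteq> J \<longrightarrow> J = I)"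

text \<open>
  Ordinals are the elements of an arbitrary well-ordered type \<open>'o\<close>: \<open>\<alpha>\<close> stands for the order
  type of \<open>{..<\<alpha>}\<close>, and the least element stands for \<open>0\<close>. \<open>rank_le H \<alpha>\<close> is the class
  \<open>T\<^sub>\<alpha>\<close>, and \<open>'a\<close> plays the role of an ambient universe containing the points of
  all ordered sets under consideration.
\<close>

context
  notes conj_cong [fundef_cong]
begin

function rank_le :: "'a rel set \<Rightarrow> 'o::wellorder \<Rightarrow> 'a rel set" where
  "rank_le H \<alpha> =
     (if \<forall>\<beta>. \<alpha> \<le> \<beta> then H \<union> {{}}
      else {X. Linear_order X \<and>
             (\<exists>M. M \<subseteq> Field X \<and> countable M \<and>
                (\<forall>I. maximal_interval X (Field X - M) I \<longrightarrow>
                   (\<exists>\<beta>. \<beta> < \<alpha> \<and> Restr X I \<in> rank_le H \<beta>)))})"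
  by auto
termination
  by (relation "inv_image {(\<beta>, \<alpha>). \<beta> < \<alpha>} snd") (simp_all add: wf_inv_image wf)

end

declare rank_le.simps [simp del]

text \<open>Order types are similarity classes.\<close>

definition order_type :: "'a rel \<Rightarrow> 'a rel set" where
  "order_type X = {Y. Linear_order Y \<and> similar X Y}"

definition representable_type :: "'a rel set \<Rightarrow> bool" where
  "representable_type \<tau> \<longleftrightarrow> (\<exists>X\<in>\<tau>. representable X)"

text \<open>
  The collection of order types generated by \<open>H\<close>. The union over all ordinals runs over the
  elements of \<open>'o\<close>; since \<open>'o\<close> is an arbitrary well-ordered type, a statement about
  \<open>generated_types TYPE('o) H\<close> for a type variable \<open>'o\<close> covers all ordinals.
\<close>

definition generated_types :: "'o::wellorder itself \<Rightarrow> 'a rel set \<Rightarrow> 'a rel set set" where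
  "generated_types _ H = {order_type X |X. X \<in> (\<Union>\<alpha>::'o. rank_le H \<alpha>)}"

lemma similar_sym:
  assumes "similar X Y" shows "similar Y X"
proof -
  obtain f where f: "bij_betw f (Field X) (Field Y)"
    and o: "\<forall>x\<in>Field X. \<forall>y\<in>Field X. (x, y) \<in> X \<longleftrightarrow> (f x, f y) \<in> Y"
    using assms unfolding similar_def by blast
  define g where "g = inv_into (Field X) f"
  have g: "bij_betw g (Field Y) (Field X)"
    using f unfolding g_def by (rule bij_betw_inv_into)
  have fg: "f (g y) = y" if "y \<in> Field Y" for y
    using f that unfolding g_def by (rule bij_betw_inv_into_right)
  have gm: "g y \<in> Field X" if "y \<in> Field Y" for y
    using g that by (rule bij_betw_apply)
  show ?thesis
    unfolding similar_def using g o fg gm by (intro exI[of _ g]) auto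
qed

lemma similar_trans:
  assumes "similar X Y" "similar Y Z" shows "similar X Z"
proof -
  obtain f g where f: "bij_betw f (Field X) (Field Y)" and g: "bij_betw g (Field Y) (Field Z)"
    and fo: "\<forall>x\<in>Field X. \<forall>y\<in>Field X. (x, y) \<in> X \<longleftrightarrow> (f x, f y) \<in> Y"
    and go: "\<forall>x\<in>Field Y. \<forall>y\<in>Field Y. (x, y) \<in> Y \<longleftrightarrow> (g x, g y) \<in> Z"
    using assms unfolding similar_def by blast
  have "f x \<in> Field Y" if "x \<in> Field X" for x
    using f that by (rule bij_betw_apply)
  then show ?thesis
    unfolding similar_def using fo go bij_betw_trans[OF f g] by (intro exI[of _ "g \<circ> f"]) auto
qed

lemma representable_similar:
  assumes "similar X Y" "representable X" shows "representable Y"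
  using assms similar_sym similar_trans unfolding representable_def by blast

lemma representable_type_iff_all:
  assumes "Linear_order X"
  shows "representable_type (order_type X) \<longleftrightarrow> (\<forall>Y\<in>order_type X. representable Y)"
proof -
  have "similar X X"
    unfolding similar_def by (intro exI[of _ id]) auto
  then show ?thesis
    using assms representable_similar similar_sym
    unfolding representable_type_def order_type_def by blast
qed

end

theory Submission
  imports Defs
begin

text \<open>
  The class of representable orders is closed under lexicographic sums along subsets of the reals:
  if \<open>\<rho>\<close> is a monotone map from \<open>X\<close> to \<open>[0, 1)\<close> all of whose fibres are representable, then
  \<open>X\<close> is representable (lemma \<open>representable_if_fibres\<close>). To see this, take a continuous
  curve \<open>t \<mapsto> (u t, v t)\<close> filling the unit square and, given \<open>x\<close> in the fibre over \<open>r\<close> and the Baire 1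
  function \<open>h\<close> representing \<open>x\<close> in that fibre, assign to \<open>x\<close> the function that is \<open>1\<close> where
  \<open>u < r\<close>, is \<open>0\<close> where \<open>u > r\<close>, and is a copy of \<open>h\<close>, squashed into \<open>(0, 1)\<close> and evaluated
  along \<open>v\<close>, where \<open>u = r\<close>. It is Baire 1, because the set where \<open>u < r\<close> is open and the set
  where \<open>u = r\<close> is closed.

  If \<open>M\<close> is a countable subset of \<open>X\<close>, enumerated as \<open>m\<^sub>0, m\<^sub>1, \<dots>\<close>, the sum over \<open>k\<close> of
  \<open>4\<^sup>-\<^sup>k\<^sup>-\<^sup>1 ([m\<^sub>k < x] + [m\<^sub>k \<le> x])\<close> is a monotone function \<open>\<rho>\<close> of \<open>x\<close> that takes
  different values at two distinct points if and only if an element of \<open>M\<close> lies between them,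
  end points included. So its fibres are the
  singletons of points of \<open>M\<close> and the nonempty maximal intervals of \<open>X - M\<close>, and representability
  propagates from the ranks below \<open>\<alpha>\<close> to rank \<open>\<alpha>\<close>. The duplication of an order
  contains a copy of the order, so every element of rank \<open>0\<close> is representable, and well-founded
  induction on the rank concludes.
\<close>

section \<open>A space-filling curve\<close>

text \<open>A continuous function of period \<open>2\<close> that vanishes on \<open>[0, 1/3]\<close> and is \<open>1\<close> on
  \<open>[2/3, 1]\<close>; if \<open>t\<close> is a point of the Cantor set, the value at \<open>3\<^sup>k t\<close> tells whether
  the ternary digit number \<open>k\<close> of \<open>t\<close>, counted from \<open>0\<close>, is \<open>0\<close> or \<open>2\<close>.\<close>

definition plateau :: "real \<Rightarrow> real" where
  "plateau t = max 0 (min 1 (1/2 - cos (pi * t)))"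

text \<open>The two coordinates \<open>i = 0\<close> and \<open>i = 1\<close> of the space-filling curve of Schoenberg: on
  the Cantor set, the binary digits of coordinate \<open>i\<close> are the halves of the ternary digits of
  \<open>t\<close> in the positions of the same parity as \<open>i\<close>.\<close>

definition schoenberg :: "nat \<Rightarrow> real \<Rightarrow> real" where
  "schoenberg i t = (\<Sum>k. plateau (3 ^ (2 * k + i) * t) / 2 ^ Suc k)"

text \<open>The point of the Cantor set with ternary digits \<open>2 a\<^sub>0, 2 a\<^sub>1, \<dots>\<close>.\<close>

definition cantor_point :: "(nat \<Rightarrow> bool) \<Rightarrow> real" where
  "cantor_point a = (\<Sum>k. 2 * of_bool (a k) / 3 ^ Suc k)"

lemma plateau_bounds: "0 \<le> plateau t" "plateau t \<le> 1"
  by (auto simp: plateau_def)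

lemma plateau_add_even: "plateau (t + 2 * real n) = plateau t"
proof -
  have "cos (pi * (t + 2 * real n)) = cos (pi * t + (2 * pi) * real n)"
    by (simp add: algebra_simps)
  also have "\<dots> = cos (pi * t)"
    using cos_int_2pin[of "int n"] sin_int_2pin[of "int n"] by (simp add: cos_add)
  finally show ?thesis by (simp add: plateau_def)
qed

lemma plateau_low:
  assumes "0 \<le> t" "t \<le> 1/3"
  shows "plateau t = 0"
proof -
  have "cos (pi / 3) \<le> cos (pi * t)"
    using assms by (intro cos_monotone_0_pi_le) (auto simp: field_simps)
  then show ?thesis by (simp add: plateau_def cos_60)
qed

lemma plateau_high:
  assumes "2/3 \<le> t" "t \<le> 1"
  shows "plateau t = 1"
proof -
  have "cos (pi * t) \<le> cos (pi * (2/3))"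
    using assms by (intro cos_monotone_0_pi_le) (auto simp: field_simps)
  also have "cos (pi * (2/3)) = - (1/2)"
    using cos_120 by (simp add: mult.commute)
  finally show ?thesis by (simp add: plateau_def)
qed

lemma continuous_on_schoenberg: "continuous_on UNIV (schoenberg i)"
proof -
  have "uniform_limit UNIV (\<lambda>n t. \<Sum>k<n. plateau (3 ^ (2 * k + i) * t) / 2 ^ Suc k)
      (\<lambda>t. \<Sum>k. plateau (3 ^ (2 * k + i) * t) / 2 ^ Suc k) sequentially"
  proof (rule Weierstrass_m_test)
    show "norm (plateau (3 ^ (2 * k + i) * t) / 2 ^ Suc k) \<le> (1/2) ^ Suc k" for k t
      using plateau_bounds[of "3 ^ (2 * k + i) * t"]
      by (simp add: power_one_over divide_right_mono)
    show "summable (\<lambda>k. (1/2) ^ Suc k :: real)"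
      by (subst summable_Suc_iff) (simp add: summable_geometric)
  qed
  then have "continuous_on UNIV (\<lambda>t. \<Sum>k. plateau (3 ^ (2 * k + i) * t) / 2 ^ Suc k)"
    by (rule uniform_limit_theorem[rotated])
       (auto simp: plateau_def intro!: continuous_intros always_eventually)
  then show ?thesis
    unfolding schoenberg_def[abs_def] .
qed

lemma summable_cantor_point: "summable (\<lambda>k. 2 * of_bool (a k) / 3 ^ Suc k :: real)"
proof (rule summable_comparison_test')
  show "summable (\<lambda>k. 2/3 * (1/3) ^ k :: real)"
    by (intro summable_mult summable_geometric) simp
  show "norm (2 * of_bool (a k) / 3 ^ Suc k :: real) \<le> 2/3 * (1/3) ^ k" for k
    by (simp add: power_one_over)
qed

lemma cantor_point_bounds: "0 \<le> cantor_point a" "cantor_point a \<le> 1"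
proof -
  show "0 \<le> cantor_point a"
    unfolding cantor_point_def by (intro suminf_nonneg summable_cantor_point) simp
  have s: "(\<lambda>k. 2/3 * (1/3) ^ k :: real) sums (2/3 * (1 / (1 - 1/3)))"
    by (intro sums_mult geometric_sums) simp
  have "cantor_point a \<le> (\<Sum>k. 2/3 * (1/3) ^ k)"
    unfolding cantor_point_def
    by (intro suminf_le summable_cantor_point sums_summable[OF s]) (simp add: power_one_over)
  also have "\<dots> = 1" using sums_unique[OF s] by simp
  finally show "cantor_point a \<le> 1" .
qed

lemma cantor_point_shift: "3 * cantor_point a = 2 * of_bool (a 0) + cantor_point (\<lambda>k. a (Suc k))"
proof -
  have "cantor_point a = 2 * of_bool (a 0) / 3 + (\<Sum>k. 2 * of_bool (a (Suc k)) / 3 ^ Suc (Suc k))"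
    unfolding cantor_point_def
    using suminf_split_head[OF summable_cantor_point[of a]] by simp
  also have "(\<Sum>k. 2 * of_bool (a (Suc k)) / 3 ^ Suc (Suc k))
      = (\<Sum>k. 1/3 * (2 * of_bool (a (Suc k)) / 3 ^ Suc k :: real))"
    by simp
  also have "\<dots> = 1/3 * cantor_point (\<lambda>k. a (Suc k))"
    unfolding cantor_point_def by (intro suminf_mult summable_cantor_point)
  finally show ?thesis by simp
qed

lemma plateau_cantor_point: "plateau (3 ^ k * cantor_point a) = of_bool (a k)"
proof (induction k arbitrary: a)
  case 0
  have "0 \<le> cantor_point (\<lambda>k. a (Suc k))" "cantor_point (\<lambda>k. a (Suc k)) \<le> 1"
    by (rule cantor_point_bounds)+
  with cantor_point_shift[of a] show ?case
    by (cases "a 0") (auto intro!: plateau_low plateau_high)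
next
  case (Suc k)
  have "3 ^ Suc k * cantor_point a = 3 ^ k * (3 * cantor_point a)" by simp
  also have "\<dots> = 3 ^ k * cantor_point (\<lambda>k. a (Suc k)) + 2 * real (3 ^ k * of_bool (a 0))"
    unfolding cantor_point_shift by (simp add: algebra_simps)
  finally show ?case by (simp only: plateau_add_even Suc.IH)
qed

text \<open>Digit number \<open>k\<close> of \<open>r\<close> is the parity of \<open>\<lfloor>2\<^sup>k\<^sup>+\<^sup>1 r\<rfloor>\<close>, and the sum of the first \<open>k\<close> terms
  telescopes to \<open>\<lfloor>2\<^sup>k r\<rfloor> / 2\<^sup>k\<close>.\<close>

lemma binary_expansion:
  fixes r :: real
  assumes "0 \<le> r" "r < 1"
  obtains a :: "nat \<Rightarrow> bool" where "(\<lambda>k. of_bool (a k) / 2 ^ Suc k) sums r"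
proof -
  define s where "s k = real_of_int \<lfloor>2 ^ k * r\<rfloor> / 2 ^ k" for k :: nat
  define a where "a k = odd \<lfloor>2 ^ Suc k * r\<rfloor>" for k :: nat
  have "s \<longlonglongrightarrow> r"
  proof (rule real_tendsto_sandwich[of "\<lambda>k. r - (1/2) ^ k"])
    show "\<forall>\<^sub>F k in sequentially. r - (1/2) ^ k \<le> s k"
    proof (rule always_eventually, rule allI)
      fix k :: nat
      have "2 ^ k * r \<le> \<lfloor>2 ^ k * r\<rfloor> + 1" by linarith
      then have "2 ^ k * r / 2 ^ k \<le> (\<lfloor>2 ^ k * r\<rfloor> + 1) / 2 ^ k"
        by (intro divide_right_mono) simp_all
      then show "r - (1/2) ^ k \<le> s k"
        by (simp add: s_def power_one_over add_divide_distrib)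
    qed
    show "\<forall>\<^sub>F k in sequentially. s k \<le> r"
    proof (rule always_eventually, rule allI)
      fix k :: nat
      have "\<lfloor>2 ^ k * r\<rfloor> \<le> 2 ^ k * r" by linarith
      then show "s k \<le> r" by (simp add: s_def field_simps)
    qed
    have "(\<lambda>k. (1/2::real) ^ k) \<longlonglongrightarrow> 0" by (rule LIMSEQ_realpow_zero) auto
    from tendsto_diff[OF tendsto_const[of r] this] show "(\<lambda>k. r - (1/2) ^ k) \<longlonglongrightarrow> r" by simp
  qed simp
  then have "(\<lambda>k. s (Suc k) - s k) sums (r - s 0)" by (rule telescope_sums)
  moreover have "s 0 = 0" using assms by (simp add: s_def floor_eq_iff)
  moreover have "s (Suc k) - s k = of_bool (a k) / 2 ^ Suc k" for k
  proof -
    have "\<lfloor>2 ^ k * r\<rfloor> = \<lfloor>2 ^ Suc k * r\<rfloor> div 2"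
    proof -
      have "2 ^ k * r = 2 ^ Suc k * r / real_of_int 2" by simp
      then show ?thesis by (simp only: floor_divide_real_eq_div)
    qed
    moreover have "\<lfloor>2 ^ Suc k * r\<rfloor> = 2 * (\<lfloor>2 ^ Suc k * r\<rfloor> div 2) + of_bool (a k)"
      unfolding a_def by (simp add: mod2_eq_if flip: minus_mod_eq_mult_div)
    ultimately have "\<lfloor>2 ^ Suc k * r\<rfloor> = 2 * \<lfloor>2 ^ k * r\<rfloor> + of_bool (a k)" by simp
    then have "real_of_int \<lfloor>2 ^ Suc k * r\<rfloor> = 2 * real_of_int \<lfloor>2 ^ k * r\<rfloor> + of_bool (a k)"
      by (simp only: of_int_add of_int_mult of_int_numeral of_int_of_bool)
    then show ?thesis by (simp add: s_def field_simps)
  qed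
  ultimately show ?thesis using that[of a] by simp
qed

lemma schoenberg_surj:
  assumes "0 \<le> r" "r < 1" "0 \<le> q" "q < 1"
  obtains t where "schoenberg 0 t = r" "schoenberg 1 t = q"
proof -
  obtain a where a: "(\<lambda>k. of_bool (a k) / 2 ^ Suc k) sums r"
    using assms(1,2) by (rule binary_expansion)
  obtain b where b: "(\<lambda>k. of_bool (b k) / 2 ^ Suc k) sums q"
    using assms(3,4) by (rule binary_expansion)
  define t where "t = cantor_point (\<lambda>k. if even k then a (k div 2) else b (k div 2))"
  have "schoenberg 0 t = r" "schoenberg 1 t = q"
    unfolding schoenberg_def t_def plateau_cantor_point
    using sums_unique[OF a] sums_unique[OF b] by simp_all
  then show ?thesis by (rule that)
qed

section \<open>Lexicographic sums along the reals\<close>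

lemma representableI:
  assumes lin: "Linear_order X"
    and baire: "\<And>x. x \<in> Field X \<Longrightarrow> baire_1 (\<phi> x)"
    and iff: "\<And>x y. x \<in> Field X \<Longrightarrow> y \<in> Field X \<Longrightarrow> (x, y) \<in> X \<longleftrightarrow> \<phi> x \<le> \<phi> y"
  shows "representable X"
proof -
  let ?F = "\<phi> ` Field X"
  have refl: "(x, x) \<in> X" if "x \<in> Field X" for x
    using lin that by (auto simp: order_on_defs refl_on_def)
  have "antisym X" and "total_on (Field X) X"
    using lin by (auto simp: order_on_defs)
  then have total: "(x, y) \<in> X \<or> (y, x) \<in> X" if "x \<in> Field X" "y \<in> Field X" for x y
    using refl that by (cases "x = y") (auto simp: total_on_def)
  have inj: "inj_on \<phi> (Field X)"
    using \<open>antisym X\<close> iff by (intro inj_onI antisymD[of X]) auto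
  have field: "Field (pointwise_order ?F) = ?F"
    by (auto simp: Field_def pointwise_order_def)
  have "linear_order_on ?F (pointwise_order ?F)"
    using total iff
    by (auto simp: order_on_defs refl_on_def trans_def antisym_def total_on_def pointwise_order_def)
  moreover have "similar X (pointwise_order ?F)"
    unfolding similar_def field using inj iff
    by (intro exI[of _ \<phi>]) (auto simp: bij_betw_def pointwise_order_def)
  ultimately show ?thesis
    unfolding representable_def using baire by (intro exI[of _ ?F]) auto
qed

lemma representableE:
  assumes "representable X"
  obtains \<phi> where "\<And>x. x \<in> Field X \<Longrightarrow> baire_1 (\<phi> x)"
    and "\<And>x y. x \<in> Field X \<Longrightarrow> y \<in> Field X \<Longrightarrow> (x, y) \<in> X \<longleftrightarrow> \<phi> x \<le> \<phi> y"
proof -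
  obtain F \<phi> where F: "\<forall>f\<in>F. baire_1 f" "linear_order_on F (pointwise_order F)"
    and bij: "bij_betw \<phi> (Field X) (Field (pointwise_order F))"
    and iff: "\<forall>x\<in>Field X. \<forall>y\<in>Field X. (x, y) \<in> X \<longleftrightarrow> (\<phi> x, \<phi> y) \<in> pointwise_order F"
    using assms unfolding representable_def similar_def by blast
  have "Field (pointwise_order F) \<subseteq> F"
    by (auto simp: Field_def pointwise_order_def)
  then have mem: "\<phi> x \<in> F" if "x \<in> Field X" for x
    using bij that by (auto simp: bij_betw_def)
  show ?thesis
    by (rule that[of \<phi>]) (use F mem iff in \<open>auto simp: pointwise_order_def\<close>)
qed

lemma representable_embedding:
  assumes "representable Y" "Linear_order X"
    and mem: "\<And>x. x \<in> Field X \<Longrightarrow> f x \<in> Field Y"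
    and iff: "\<And>x y. x \<in> Field X \<Longrightarrow> y \<in> Field X \<Longrightarrow> (x, y) \<in> X \<longleftrightarrow> (f x, f y) \<in> Y"
  shows "representable X"
proof -
  obtain \<phi> where \<phi>: "\<And>x. x \<in> Field Y \<Longrightarrow> baire_1 (\<phi> x)"
    "\<And>x y. x \<in> Field Y \<Longrightarrow> y \<in> Field Y \<Longrightarrow> (x, y) \<in> Y \<longleftrightarrow> \<phi> x \<le> \<phi> y"
    using representableE[OF assms(1)] by blast
  show ?thesis
    using assms(2) by (rule representableI[where \<phi> = "\<phi> \<circ> f"]) (simp_all add: \<phi> mem iff)
qed

text \<open>An increasing homeomorphism from the reals to \<open>(0, 1)\<close>.\<close>

definition squash :: "real \<Rightarrow> real" where
  "squash y = 1/2 + arctan y / pi"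

lemma squash_bounds: "0 < squash y" "squash y < 1"
  using arctan_bounded[of y] pi_gt_zero by (auto simp: squash_def field_simps)

lemma squash_le_iff: "squash x \<le> squash y \<longleftrightarrow> x \<le> y"
  by (simp add: squash_def divide_le_cancel arctan_le_iff)

text \<open>The function representing, in a lexicographic sum, the element represented by \<open>h\<close> of the
  summand over \<open>r\<close>. The second coordinate \<open>q\<close> of the curve ranges over \<open>[0, 1]\<close>, so
  \<open>w = 2 q - 1\<close> ranges over \<open>[-1, 1]\<close>, and \<open>w \<mapsto> w / (1 - \<bar>w\<bar>)\<close> maps \<open>(-1, 1)\<close> onto the reals.
  At the end points of \<open>[-1, 1]\<close>, where \<open>h\<close> cannot be evaluated, the value is \<open>0\<close>.\<close>

definition stack :: "real \<Rightarrow> (real \<Rightarrow> real) \<Rightarrow> real \<Rightarrow> real" where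
  "stack r h t =
     (let u = schoenberg 0 t; w = 2 * schoenberg 1 t - 1 in
      if u < r then 1
      else if u = r \<and> \<bar>w\<bar> < 1 then squash (h (w / (1 - \<bar>w\<bar>)))
      else 0)"

lemma eventually_real_mult_ge:
  fixes d c :: real
  assumes "0 < d"
  shows "\<forall>\<^sub>F n in sequentially. c \<le> real n * d"
proof -
  obtain N where N: "c / d \<le> real N" using real_arch_simple by blast
  have "\<forall>\<^sub>F n in sequentially. N \<le> n" by (rule eventually_ge_at_top)
  then show ?thesis
  proof eventually_elim
    case (elim n)
    then have "c / d \<le> real n" using N by linarith
    then show ?case using assms by (simp add: field_simps)
  qed
qed

lemma baire_1_stack:
  assumes "baire_1 h"
  shows "baire_1 (stack r h)"
proof -
  obtain g where cont: "\<And>n. continuous_on UNIV (g n)" and lim: "\<And>x. (\<lambda>n. g n x) \<longlonglongrightarrow> h x"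
    using assms unfolding baire_1_def by blast
  define u where "u = schoenberg 0"
  define w where "w t = 2 * schoenberg 1 t - 1" for t
  have contu: "continuous_on UNIV u"
    unfolding u_def by (rule continuous_on_schoenberg)
  have contw: "continuous_on UNIV w"
    unfolding w_def by (intro continuous_intros continuous_on_schoenberg)
  \<comment> \<open>Continuous approximations of the indicators of \<open>u < r\<close>, of \<open>u = r\<close> and of \<open>\<bar>w\<bar> < 1\<close>, and of
    the map \<open>w / (1 - \<bar>w\<bar>)\<close>; at each point they are eventually exact, except for the last one
    outside \<open>\<bar>w\<bar> < 1\<close>.\<close>
  define L where "L n t = max 0 (min 1 (real n * (r - u t)))" for n t
  define E where "E n t = max 0 (1 - real n * \<bar>u t - r\<bar>)" for n t
  define B where "B n t = max 0 (min 1 (real n * (1 - \<bar>w t\<bar>)))" for n t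
  define P where "P n t = w t / max (1 - \<bar>w t\<bar>) (1 / real (Suc n))" for n t
  define G where "G n t = L n t + E n t * (B n t * squash (g n (P n t)))" for n t
  have "continuous_on UNIV (G n)" for n
  proof -
    have "0 < max (1 - \<bar>w t\<bar>) (1 / real (Suc n))" for t
      by (intro less_max_iff_disj[THEN iffD2] disjI2) simp
    then have "max (1 - \<bar>w t\<bar>) (1 / real (Suc n)) \<noteq> 0" for t
      by (rule less_imp_neq[symmetric])
    then have "continuous_on UNIV (P n)"
      unfolding P_def by (intro continuous_intros contw) auto
    then have "continuous_on UNIV (\<lambda>t. g n (P n t))"
      by (rule continuous_on_compose2[OF cont]) simp
    then show ?thesis
      unfolding G_def L_def E_def B_def squash_def
      by (intro continuous_intros contu contw) auto
  qed
  moreover have "(\<lambda>n. G n t) \<longlonglongrightarrow> stack r h t" for t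
  proof (cases "u t = r")
    case False
    have "0 < \<bar>u t - r\<bar>" using False by simp
    from eventually_real_mult_ge[OF this, of 1]
    have "\<forall>\<^sub>F n in sequentially. G n t = stack r h t"
    proof eventually_elim
      case (elim n)
      have "L n t = (if u t < r then 1 else 0)"
      proof (cases "u t < r")
        case True
        then show ?thesis using elim by (simp add: L_def)
      next
        case False
        then have "real n * (r - u t) \<le> 0" by (simp add: mult_nonneg_nonpos)
        with False show ?thesis by (simp add: L_def)
      qed
      moreover have "E n t = 0" using elim by (simp add: E_def)
      ultimately show ?case
        using False by (simp add: G_def stack_def Let_def u_def)
    qed
    then show ?thesis by (rule tendsto_eventually)
  next
    case u: True
    have G: "G n t = B n t * squash (g n (P n t))" for n
      by (simp add: G_def L_def E_def u)
    show ?thesis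
    proof (cases "\<bar>w t\<bar> < 1")
      case False
      then have "real n * (1 - \<bar>w t\<bar>) \<le> 0" for n by (simp add: mult_nonneg_nonpos)
      then have "B n t = 0" for n unfolding B_def by (intro max_absorb1) (simp add: min.coboundedI2)
      moreover have "stack r h t = 0"
        using u False by (simp add: stack_def Let_def u_def w_def)
      ultimately show ?thesis by (simp add: G)
    next
      case True
      let ?y = "w t / (1 - \<bar>w t\<bar>)"
      have pos: "0 < 1 - \<bar>w t\<bar>" using True by simp
      from eventually_real_mult_ge[OF pos, of 1]
      have "\<forall>\<^sub>F n in sequentially. squash (g n ?y) = G n t"
      proof eventually_elim
        case (elim n)
        have "1 \<le> real (Suc n) * (1 - \<bar>w t\<bar>)" using elim pos by (simp add: algebra_simps)
        then have "1 / real (Suc n) \<le> 1 - \<bar>w t\<bar>"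
          by (simp add: divide_le_eq mult.commute del: of_nat_Suc)
        then have "P n t = ?y" by (simp add: P_def max_absorb1 del: of_nat_Suc)
        moreover have "B n t = 1" using elim by (simp add: B_def)
        ultimately show ?case by (simp add: G)
      qed
      moreover have "(\<lambda>n. squash (g n ?y)) \<longlonglongrightarrow> squash (h ?y)"
        unfolding squash_def by (intro tendsto_intros lim) simp
      moreover have "stack r h t = squash (h ?y)"
        using u True by (simp add: stack_def Let_def u_def w_def)
      ultimately show ?thesis
        using Lim_transform_eventually by simp
    qed
  qed
  ultimately show ?thesis unfolding baire_1_def by blast
qed

lemma stack_le_iff:
  assumes "0 \<le> r" "r < 1"
  shows "stack r h \<le> stack r h' \<longleftrightarrow> h \<le> h'"
proof
  assume "h \<le> h'"
  then show "stack r h \<le> stack r h'"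
    by (auto simp: le_fun_def stack_def Let_def squash_le_iff)
next
  assume le: "stack r h \<le> stack r h'"
  show "h \<le> h'"
  proof (rule le_funI)
    fix y :: real
    \<comment> \<open>The inverse of \<open>w \<mapsto> w / (1 - \<bar>w\<bar>)\<close>.\<close>
    define w where "w = y / (1 + \<bar>y\<bar>)"
    have w: "\<bar>w\<bar> < 1" by (simp add: w_def abs_divide)
    have "1 - \<bar>w\<bar> = 1 / (1 + \<bar>y\<bar>)"
      by (simp add: w_def abs_divide field_simps)
    then have y: "w / (1 - \<bar>w\<bar>) = y" by (simp add: w_def)
    have "0 \<le> (w + 1) / 2" "(w + 1) / 2 < 1" using w by auto
    with assms obtain t where t: "schoenberg 0 t = r" "schoenberg 1 t = (w + 1) / 2"
      using schoenberg_surj by blast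
    then have "2 * schoenberg 1 t - 1 = w" by simp
    then have "stack r f t = squash (f y)" for f
      using t(1) w y by (simp add: stack_def)
    then show "h y \<le> h' y" using le_funD[OF le, of t] by (simp add: squash_le_iff)
  qed
qed

lemma stack_le:
  assumes "r < r'"
  shows "stack r h \<le> stack r' h'"
proof (rule le_funI)
  fix t
  have "stack r h t \<le> 1" "0 \<le> stack r' h' t"
    using squash_bounds less_imp_le by (auto simp: stack_def Let_def)
  moreover have "stack r h t = 0 \<or> stack r' h' t = 1"
    using assms by (auto simp: stack_def Let_def)
  ultimately show "stack r h t \<le> stack r' h' t" by auto
qed

lemma stack_not_le:
  assumes "r < r'" "0 \<le> r" "r < 1"
  shows "\<not> stack r' h' \<le> stack r h"
proof -
  \<comment> \<open>At a point where the first coordinate is \<open>r\<close>, the squashed value stays below \<open>1\<close>.\<close>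
  obtain t where t: "schoenberg 0 t = r" "schoenberg 1 t = 0"
    using assms schoenberg_surj[of r 0] by auto
  then have "stack r' h' t = 1" "stack r h t < 1"
    using assms squash_bounds(2) by (auto simp: stack_def Let_def)
  then show ?thesis by (metis le_funD not_le)
qed

text \<open>The monotone map \<open>\<rho>\<close> presents \<open>X\<close> as the lexicographic sum of its fibres.\<close>

lemma representable_if_fibres:
  fixes \<rho> :: "'a \<Rightarrow> real"
  assumes lin: "Linear_order X"
    and range: "\<And>x. x \<in> Field X \<Longrightarrow> 0 \<le> \<rho> x \<and> \<rho> x < 1"
    and mono: "\<And>x y. (x, y) \<in> X \<Longrightarrow> \<rho> x \<le> \<rho> y"
    and fibre: "\<And>x. x \<in> Field X \<Longrightarrow> representable (Restr X {y \<in> Field X. \<rho> y = \<rho> x})"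
  shows "representable X"
proof -
  define fib where "fib r = {y \<in> Field X. \<rho> y = r}" for r
  have refl: "(x, x) \<in> X" if "x \<in> Field X" for x
    using lin that by (auto simp: order_on_defs refl_on_def)
  have field: "Field (Restr X (fib r)) = fib r" for r
    using refl by (auto simp: Field_def fib_def)
  have "\<exists>\<phi>. \<forall>x\<in>fib r. baire_1 (\<phi> x) \<and> (\<forall>y\<in>fib r. (x, y) \<in> X \<longleftrightarrow> \<phi> x \<le> \<phi> y)" for r
  proof (cases "fib r = {}")
    case False
    then obtain x where "x \<in> Field X" "\<rho> x = r" unfolding fib_def by blast
    with fibre have "representable (Restr X (fib r))" unfolding fib_def by blast
    then obtain \<phi> where "\<And>x. x \<in> fib r \<Longrightarrow> baire_1 (\<phi> x)"
      and "\<And>x y. x \<in> fib r \<Longrightarrow> y \<in> fib r \<Longrightarrow> (x, y) \<in> Restr X (fib r) \<longleftrightarrow> \<phi> x \<le> \<phi> y"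
      by (rule representableE) (use field in blast)
    then show ?thesis by (intro exI[of _ \<phi>]) auto
  qed simp
  then have "\<exists>\<phi>. \<forall>r. \<forall>x\<in>fib r. baire_1 (\<phi> r x) \<and> (\<forall>y\<in>fib r. (x, y) \<in> X \<longleftrightarrow> \<phi> r x \<le> \<phi> r y)"
    by (intro choice allI)
  then obtain \<phi> where \<phi>: "\<And>r x. x \<in> fib r \<Longrightarrow> baire_1 (\<phi> r x)"
    "\<And>r x y. x \<in> fib r \<Longrightarrow> y \<in> fib r \<Longrightarrow> (x, y) \<in> X \<longleftrightarrow> \<phi> r x \<le> \<phi> r y"
    by blast
  show ?thesis
  proof (rule representableI[OF lin])
    fix x assume "x \<in> Field X"
    then show "baire_1 (stack (\<rho> x) (\<phi> (\<rho> x) x))"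
      by (intro baire_1_stack \<phi>(1)) (simp add: fib_def)
  next
    fix x y assume xy: "x \<in> Field X" "y \<in> Field X"
    have total: "(x, y) \<in> X \<or> (y, x) \<in> X"
      using lin xy refl by (cases "x = y") (auto simp: order_on_defs total_on_def)
    consider "\<rho> x < \<rho> y" | "\<rho> x = \<rho> y" | "\<rho> y < \<rho> x" by linarith
    then show "(x, y) \<in> X \<longleftrightarrow> stack (\<rho> x) (\<phi> (\<rho> x) x) \<le> stack (\<rho> y) (\<phi> (\<rho> y) y)"
    proof cases
      case 1
      then have "(x, y) \<in> X" using total mono[of y x] by auto
      with 1 show ?thesis by (simp add: stack_le)
    next
      case 2
      then have "x \<in> fib (\<rho> y)" "y \<in> fib (\<rho> y)" using xy by (auto simp: fib_def)
      with 2 show ?thesis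
        using \<phi>(2) range[OF xy(2)] by (simp add: stack_le_iff)
    next
      case 3
      then have "(x, y) \<notin> X" using mono[of x y] by auto
      with 3 show ?thesis using range[OF xy(2)] by (simp add: stack_not_le)
    qed
  qed
qed

section \<open>Splitting an order by a countable set\<close>

text \<open>A monotone map that separates two distinct points if and only if an element of \<open>M\<close> lies
  between them, end points included. The weight of each element \<open>m\<close> of \<open>M\<close> is counted once at
  \<open>m\<close> and twice above \<open>m\<close>, so that \<open>m\<close> is separated from the points on both sides.\<close>

lemma countable_splitting_map:
  assumes lin: "Linear_order X" and M: "M \<subseteq> Field X" "countable M"
  obtains \<rho> :: "'a \<Rightarrow> real" where "\<And>x. 0 \<le> \<rho> x \<and> \<rho> x < 1"
    and "\<And>x y. (x, y) \<in> X \<Longrightarrow> \<rho> x \<le> \<rho> y"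
    and "\<And>x y m. (x, m) \<in> X \<Longrightarrow> (m, y) \<in> X \<Longrightarrow> x \<noteq> y \<Longrightarrow> m \<in> M \<Longrightarrow> \<rho> x < \<rho> y"
    and "\<And>x y. (x, y) \<in> X \<Longrightarrow> \<rho> x \<noteq> \<rho> y \<Longrightarrow> \<exists>m\<in>M. (x, m) \<in> X \<and> (m, y) \<in> X"
proof -
  have trans: "\<And>x y z. (x, y) \<in> X \<Longrightarrow> (y, z) \<in> X \<Longrightarrow> (x, z) \<in> X"
    and antisym: "\<And>x y. (x, y) \<in> X \<Longrightarrow> (y, x) \<in> X \<Longrightarrow> x = y"
    and refl: "\<And>x. x \<in> Field X \<Longrightarrow> (x, x) \<in> X"
    using lin by (auto simp: order_on_defs refl_on_def dest: transD antisymD)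
  have total: "(x, y) \<in> X \<or> (y, x) \<in> X" if "x \<in> Field X" "y \<in> Field X" for x y
    using lin refl that by (cases "x = y") (auto simp: order_on_defs total_on_def)
  obtain e :: "nat \<Rightarrow> 'a" where e: "M \<subseteq> range e"
    using M(2) by (metis countable_as_injective_image_subset image_mono top_greatest)
  define c :: "'a \<Rightarrow> 'a \<Rightarrow> real" where
    "c m x = of_bool (m \<in> M) * (of_bool ((m, x) \<in> X) + of_bool ((m, x) \<in> X \<and> m \<noteq> x))" for m x
  define \<rho> where "\<rho> x = (\<Sum>k. c (e k) x / 4 ^ Suc k)" for x
  have c: "0 \<le> c m x" "c m x \<le> 2" for m x by (auto simp: c_def)
  have geo: "(\<lambda>k. 1/2 * (1/4) ^ k :: real) sums (1/2 * (1 / (1 - 1/4)))"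
    by (intro sums_mult geometric_sums) simp
  have bound: "c (e k) x / 4 ^ Suc k \<le> 1/2 * (1/4) ^ k" for k x
  proof -
    have "c (e k) x / 4 ^ Suc k \<le> 2 / 4 ^ Suc k" by (intro divide_right_mono c) simp
    then show ?thesis by (simp add: power_one_over)
  qed
  have summ: "summable (\<lambda>k. c (e k) x / 4 ^ Suc k)" for x
    using bound c by (intro summable_comparison_test'[OF sums_summable[OF geo]]) simp
  have cmono: "c m x \<le> c m y" if "(x, y) \<in> X" for m x y
    using trans[of m x y] antisym[of x y] that by (auto simp: c_def)
  have mono: "\<rho> x \<le> \<rho> y" if "(x, y) \<in> X" for x y
    unfolding \<rho>_def using cmono[OF that] by (intro suminf_le summ divide_right_mono) auto
  have strict: "\<rho> x < \<rho> y" if m: "(x, m) \<in> X" "(m, y) \<in> X" "x \<noteq> y" "m \<in> M" for x y m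
  proof -
    obtain k where k: "m = e k" using e m(4) by blast
    have "c m x < c m y"
    proof (cases "m = x")
      case True
      then show ?thesis using m refl[of x] by (auto simp: c_def FieldI1)
    next
      case False
      then have "(m, x) \<notin> X" using antisym m(1) by blast
      then show ?thesis using m by (auto simp: c_def)
    qed
    then have "0 < (\<Sum>k. c (e k) y / 4 ^ Suc k - c (e k) x / 4 ^ Suc k)"
      using cmono[OF trans[OF m(1,2)]] k
      by (intro suminf_pos2[of _ k] summable_diff summ) (auto simp: divide_right_mono divide_strict_right_mono)
    also have "\<dots> = \<rho> y - \<rho> x"
      unfolding \<rho>_def by (rule suminf_diff[symmetric]) (rule summ)+
    finally show ?thesis by simp
  qed
  have between: "\<exists>m\<in>M. (x, m) \<in> X \<and> (m, y) \<in> X" if xy: "(x, y) \<in> X" "\<rho> x \<noteq> \<rho> y" for x y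
  proof (rule ccontr)
    assume none: "\<not> ?thesis"
    have "c m x = c m y" for m
    proof (cases "m \<in> M")
      case True
      then have not: "\<not> ((x, m) \<in> X \<and> (m, y) \<in> X)" using none by blast
      have "(x, m) \<in> X \<or> (m, x) \<in> X" using True M(1) xy(1) by (intro total) (auto simp: FieldI1)
      then have "(m, x) \<in> X \<and> m \<noteq> x \<longleftrightarrow> (m, y) \<in> X \<and> m \<noteq> y" "(m, x) \<in> X \<longleftrightarrow> (m, y) \<in> X"
        using not xy(1) trans[of m x y] refl[of x] refl[of y]
        by (auto simp: FieldI1 FieldI2)
      then show ?thesis by (simp add: c_def)
    qed (simp add: c_def)
    then show False using xy(2) by (simp add: \<rho>_def)
  qed
  have "\<rho> x \<le> 1/2 * (1 / (1 - 1/4))" for x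
    unfolding \<rho>_def sums_unique[OF geo] using bound by (intro suminf_le summ sums_summable[OF geo])
  then have "\<rho> x < 1" for x
    by (rule order.strict_trans1) simp
  moreover have "0 \<le> \<rho> x" for x
    unfolding \<rho>_def using c by (intro suminf_nonneg summ) simp
  ultimately show ?thesis using that[of \<rho>] mono strict between by blast
qed

text \<open>The fibres of the splitting map through points outside \<open>M\<close> are maximal intervals of the
  complement of \<open>M\<close>, and the other fibres are singletons.\<close>

lemma representable_if_countable_split:
  assumes lin: "Linear_order X" and M: "M \<subseteq> Field X" "countable M"
    and parts: "\<And>I. maximal_interval X (Field X - M) I \<Longrightarrow> representable (Restr X I)"
  shows "representable X"
proof -
  have trans: "\<And>x y z. (x, y) \<in> X \<Longrightarrow> (y, z) \<in> X \<Longrightarrow> (x, z) \<in> X"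
    and refl: "\<And>x. x \<in> Field X \<Longrightarrow> (x, x) \<in> X"
    using lin by (auto simp: order_on_defs refl_on_def dest: transD)
  have total: "(x, y) \<in> X \<or> (y, x) \<in> X" if "x \<in> Field X" "y \<in> Field X" for x y
    using lin refl that by (cases "x = y") (auto simp: order_on_defs total_on_def)
  obtain \<rho> :: "'a \<Rightarrow> real" where range: "\<And>x. 0 \<le> \<rho> x \<and> \<rho> x < 1"
    and mono: "\<And>x y. (x, y) \<in> X \<Longrightarrow> \<rho> x \<le> \<rho> y"
    and strict: "\<And>x y m. (x, m) \<in> X \<Longrightarrow> (m, y) \<in> X \<Longrightarrow> x \<noteq> y \<Longrightarrow> m \<in> M \<Longrightarrow> \<rho> x < \<rho> y"
    and between: "\<And>x y. (x, y) \<in> X \<Longrightarrow> \<rho> x \<noteq> \<rho> y \<Longrightarrow> \<exists>m\<in>M. (x, m) \<in> X \<and> (m, y) \<in> X"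
    using countable_splitting_map[OF lin M] by blast
  show ?thesis
  proof (rule representable_if_fibres[OF lin range mono])
    fix x assume x: "x \<in> Field X"
    define I where "I = {y \<in> Field X. \<rho> y = \<rho> x}"
    have in_M: "y = m" if "y \<in> Field X" "m \<in> M" "\<rho> y = \<rho> m" for y m
    proof (rule ccontr)
      assume "y \<noteq> m"
      have "m \<in> Field X" using M that(2) by auto
      then have "\<rho> y < \<rho> m \<or> \<rho> m < \<rho> y"
        using total[OF that(1), of m] refl[of m] strict[of y m m] strict[of m m y] \<open>y \<noteq> m\<close> that(2)
        by auto
      then show False using that(3) by simp
    qed
    have "representable (Restr X I)"
    proof (cases "x \<in> M")
      case True
      then have I: "I = {x}" using in_M x by (auto simp: I_def)
      have R: "Restr X I = {(x, x)}" unfolding I using refl[OF x] by auto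
      have "baire_1 (\<lambda>_. 0)"
        unfolding baire_1_def by (intro exI[of _ "\<lambda>_ _. 0"]) auto
      then show ?thesis
        unfolding R
        by (intro representableI[where \<phi> = "\<lambda>_ _. 0"])
           (auto simp: order_on_defs refl_on_def trans_def antisym_def total_on_def)
    next
      case False
      have "order_convex X I"
        unfolding order_convex_def
      proof (intro conjI ballI allI impI)
        show "I \<subseteq> Field X" by (auto simp: I_def)
        fix a b y assume "a \<in> I" "b \<in> I" "(a, y) \<in> X \<and> (y, b) \<in> X"
        then show "y \<in> I"
          using mono[of a y] mono[of y b] by (auto simp: I_def FieldI1)
      qed
      moreover have "I \<subseteq> Field X - M"
      proof
        fix y assume "y \<in> I"
        then show "y \<in> Field X - M" using in_M[OF x, of y] False by (auto simp: I_def)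
      qed
      moreover have "J = I" if J: "order_convex X J" "J \<subseteq> Field X - M" "I \<subseteq> J" for J
      proof -
        have xJ: "x \<in> J" using J(3) x by (auto simp: I_def)
        have no_M: "m \<notin> M" if "a \<in> J" "b \<in> J" "(a, m) \<in> X" "(m, b) \<in> X" for a b m
          using J(1,2) that unfolding order_convex_def by blast
        have "y \<in> I" if y: "y \<in> J" for y
        proof -
          have "y \<in> Field X" using J(2) y by auto
          from total[OF this x] have "\<rho> y = \<rho> x"
          proof
            assume "(y, x) \<in> X"
            then show ?thesis using between[of y x] no_M[OF y xJ] by blast
          next
            assume "(x, y) \<in> X"
            then have "\<rho> x = \<rho> y" using between[of x y] no_M[OF xJ y] by blast
            then show ?thesis by simp
          qed
          with \<open>y \<in> Field X\<close> show ?thesis by (simp add: I_def)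
        qed
        with J(3) show ?thesis by auto
      qed
      ultimately have "maximal_interval X (Field X - M) I"
        unfolding maximal_interval_def by blast
      then show ?thesis by (rule parts)
    qed
    then show "representable (Restr X {y \<in> Field X. \<rho> y = \<rho> x})" unfolding I_def .
  qed
qed

section \<open>Induction on the rank\<close>

lemma representable_if_duplication:
  assumes "Linear_order X" "representable (duplication X)"
  shows "representable X"
proof (rule representable_embedding[OF assms(2,1), where f = "\<lambda>x. (x, 0)"])
  have refl: "(x, x) \<in> X" if "x \<in> Field X" for x
    using assms(1) that by (auto simp: order_on_defs refl_on_def)
  show "(x, 0) \<in> Field (duplication X)" if "x \<in> Field X" for x
    using that by (intro FieldI1[of _ "(x, 0)"]) (simp add: duplication_def)
  show "(x, y) \<in> X \<longleftrightarrow> ((x, 0), (y, 0)) \<in> duplication X" if "x \<in> Field X" "y \<in> Field X" for x y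
    using that refl by (auto simp: duplication_def)
qed

lemma linear_and_representable_if_rank_le:
  fixes H :: "'a rel set" and \<alpha> :: "'o::wellorder"
  assumes H: "\<forall>X\<in>H. Linear_order X"
    and dup: "\<forall>X\<in>H \<union> {{}}. representable (duplication X)"
    and X: "X \<in> rank_le H \<alpha>"
  shows "Linear_order X \<and> representable X"
  using X
proof (induction \<alpha> arbitrary: X rule: less_induct)
  case (less \<alpha>)
  show ?case
  proof (cases "\<forall>\<beta>. \<alpha> \<le> \<beta>")
    case True
    have "rank_le H \<alpha> = H \<union> {{}}" by (rule trans[OF rank_le.simps if_P]) (fact True)
    with less.prems have "X \<in> H \<union> {{}}" by blast
    moreover from this have "Linear_order X" using H by (auto simp: order_on_defs refl_on_def)
    ultimately show ?thesis using dup representable_if_duplication by blast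
  next
    case False
    with less.prems obtain M where lin: "Linear_order X" and M: "M \<subseteq> Field X" "countable M"
      and parts: "\<forall>I. maximal_interval X (Field X - M) I \<longrightarrow>
        (\<exists>\<beta>. \<beta> < \<alpha> \<and> Restr X I \<in> rank_le H \<beta>)"
      by (auto simp: rank_le.simps[of H \<alpha>])
    have "representable X"
      using lin M by (rule representable_if_countable_split) (use parts less.IH in blast)
    with lin show ?thesis by blast
  qed
qed

theorem corollary4p5:
  fixes H :: "'a rel set"
  assumes "\<forall>X\<in>H. Linear_order X"
    and "\<forall>X\<in>H \<union> {{}}. representable (duplication X)"
  shows "\<forall>\<tau>\<in>generated_types TYPE('o::wellorder) H. representable_type \<tau>"
proof
  fix \<tau> assume "\<tau> \<in> generated_types TYPE('o) H"
  then obtain X and \<alpha> :: 'o where \<tau>: "\<tau> = order_type X" and "X \<in> rank_le H \<alpha>"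
    unfolding generated_types_def by blast
  then have X: "Linear_order X" "representable X"
    using linear_and_representable_if_rank_le[OF assms] by blast+
  then have "\<forall>Y\<in>order_type X. representable Y"
    using representable_similar unfolding order_type_def by blast
  then show "representable_type \<tau>"
    unfolding \<tau> using representable_type_iff_all[OF X(1)] by blast
qed

end
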